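(* Let $M=\begin{bmatrix}a&b\\ c&d\end{bmatrix}$ and an integer $r\ge 0$ be such that $S_{M,r,+}$ (respectively $S_{M,r,-}$) is a similarity map of the rational butterfly. The similarity map $S=S_{M,r,+}$ maps the gap labeled $(s,t)$ to the gap labeled $(s',t')$ according to the formula $$\begin{bmatrix}s'\\ t'\end{bmatrix}=(ad-bc)\begin{bmatrix}a&b\\ c&d\end{bmatrix}\begin{bmatrix}s\\ t\end{bmatrix}+\begin{bmatrix}0\\ r\end{bmatrix}.$$ Also, the similarity map $S=S_{M,r,-}$ maps the gap labeled $(s,t)$ to the gap labeled $(s',t')$ according to the formula $$\begin{bmatrix}s'\\ t'\end{bmatrix}=(ad-bc)\begin{bmatrix}a&b\\ c&d\end{bmatrix}\begin{bmatrix}s\\ t\end{bmatrix}+\begin{bmatrix}r\\ r\end{bmatrix}.$$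
   Context: Spectra. For real $\theta$, $A_\theta$ is the universal C*-algebra generated by unitaries $u,v$ with $vu=e^{2\pi i\theta}uv$, and $h_\theta=u+u^*+v+v^*$. Rational $\theta\in[0,1]$ are written $\theta=p/q$ in lowest terms with $q\ge1$ (so $0=0/1$, $1=1/1$). The spectrum of $h_{p/q}$ is a union of $q$ closed intervals $I_1,\dots,I_q$ numbered from left to right, pairwise disjoint except that for $q$ even $I_{q/2}\cap I_{q/2+1}=\{0\}$. The rational butterfly is the set of $(x,\theta)$ with $\theta\in\mathbb{Q}\cap[0,1]$ and $x\in \mathrm{Spec}(h_\theta)$. Polynomials. Let $U$ be the $q\times q$ cyclic permutation matrix, $V=\mathrm{diag}(1,\omega,\dots,\omega^{q-1})$ with $\omega=e^{2\pi i p/q}$, and $P_{p/q}(x)=\det(xI-(U+U^*+V+V^* ))+4$. Then $\mathrm{Spec}(h_{p/q})=\{x\in\mathbb{R}: |P_{p/q}(x)|\le4\}$, and $(-1)^{q+k}P_{p/q}$ maps $I_k$ increasingly onto $[-4,4]$. Similarity maps. Let $M=\begin{bmatrix}a&b\\ c&d\end{bmatrix}\in GL_2(\mathbb{Z})$ (taken modulo $\pm I$) be such that $\theta\mapsto\theta'=\frac{a\theta+b}{c\theta+d}$ maps $[0,1]$ into itself; the representative is chosen with $c\theta+d>0$ on $[0,1]$, so that for $\theta=p/q$ one has $\theta'=p'/q'$ in lowest terms with $p'=ap+bq$, $q'=cp+dq>0$. Let $I'_1,\dots,I'_{q'}$ be the intervals of $\mathrm{Spec}(h_{\theta'})$ numbered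 from left to right. Let $r\ge0$ be an integer such that $r p'+q\le q'$ (for the sign $+$), respectively $r(q'-p')+q\le q'$ (for the sign $-$), for every rational $\theta=p/q\in[0,1]$. The similarity map $S_{M,r,\pm}$ sends $(x,\theta)$ with $x\in I_k$ to $(x',\theta')$, where $x'\in I'_{k'}$ is determined by $(-1)^{q+k}P_\theta(x)=(-1)^{q'+k'}P_{\theta'}(x')$, with $k'=rp'+k$ for $S_{M,r,+}$ and $k'=r(q'-p')+k$ for $S_{M,r,-}$. (At $x=0$ with $q$ even, both images, via $k=q/2$ and $k=q/2+1$, are taken as values.) Gaps. For $1\le k\le q-1$, the $k$-th gap at level $p/q$ is the gap between $I_k$ and $I_{k+1}$ (closed, i.e. empty, when $q$ is even and $k=q/2$). For fixed integers $(s,t)$, the gap labeled $(s,t)$ at level $p/q$ is the $k$-th gap with $k=tp-sq$ (when $1\le k\le q-1$); the labels are limited to $0\le s\le t-1$ if $t>0$ and $t\le s\le -1$ if $t<0$. The map $S_{M,r,\pm}$ sends the $k$-th gap at level $\theta$ to the $k'$-th gap at level $\theta'$, where $k'=rp'+k$ for the sign $+$ and $k'=r(q'-p')+k$ for the sign $-$.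
   Formalization: For S_{M,r,-} the added vector is -(r,r), not +(r,r). As printed it fails: for M=[[0,1],[1,1]], r=1, θ=2/5, label (1,4) is gap 3 and goes to gap 5 at level 5/7, but the printed formula gives (-3,-4), which labels gap 1. *)

theory Defs
  imports Complex_Main "Jordan_Normal_Form.Determinant" "Jordan_Normal_Form.Schur_Decomposition"
begin

section \<open>The rotation algebra and the spectrum of \<open>h\<close>\<close>

text \<open>
  The dense *-subalgebra of the rotation algebra spanned by the monomials \<open>u\<^sup>m v\<^sup>n\<close>: a finitely
  supported \<open>f\<close> stands for the sum of all \<open>f (m, n) u\<^sup>m v\<^sup>n\<close>. The relation \<open>v u = e u v\<close>, where
  \<open>e = cis (2 pi \<theta>)\<close>, gives \<open>v\<^sup>n u\<^sup>m = e\<^sup>m\<^sup>n u\<^sup>m v\<^sup>n\<close>, which yields the product and the involution below.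
\<close>

type_synonym laurent = "int \<times> int \<Rightarrow> complex"

definition laurents :: "laurent set" where
  "laurents = {f. finite {i. f i \<noteq> 0}}"

definition rot_mult :: "real \<Rightarrow> laurent \<Rightarrow> laurent \<Rightarrow> laurent" where
  "rot_mult \<theta> f g = (\<lambda>(m, n). \<Sum>(i, j)\<in>{ij. f ij \<noteq> 0}.
      f (i, j) * g (m - i, n - j) * cis (2 * pi * \<theta> * of_int (j * (m - i))))"

definition rot_star :: "real \<Rightarrow> laurent \<Rightarrow> laurent" where
  "rot_star \<theta> f = (\<lambda>(m, n). cnj (f (- m, - n)) * cis (2 * pi * \<theta> * of_int (m * n)))"

definition rot_one :: laurent where
  "rot_one = (\<lambda>i. if i = (0, 0) then 1 else 0)"

definition rot_h :: laurent where
  "rot_h = (\<lambda>i. if i \<in> {(1, 0), (- 1, 0), (0, 1), (0, - 1)} then 1 else 0)"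

definition cstar_seminorm :: "real \<Rightarrow> (laurent \<Rightarrow> real) \<Rightarrow> bool" where
  "cstar_seminorm \<theta> N \<longleftrightarrow>
     (\<forall>f\<in>laurents. 0 \<le> N f) \<and>
     (\<forall>f\<in>laurents. \<forall>z. N (\<lambda>i. z * f i) = cmod z * N f) \<and>
     (\<forall>f\<in>laurents. \<forall>g\<in>laurents. N (\<lambda>i. f i + g i) \<le> N f + N g) \<and>
     (\<forall>f\<in>laurents. \<forall>g\<in>laurents. N (rot_mult \<theta> f g) \<le> N f * N g) \<and>
     (\<forall>f\<in>laurents. N (rot_mult \<theta> (rot_star \<theta> f) f) = (N f)\<^sup>2)"

text \<open>
  The norm of the universal C*-algebra is the largest C*-seminorm. The supremum exists, since
  monomials are unitary and every C*-seminorm is therefore bounded by the sum of the absolute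
  values of the coefficients.
\<close>

definition rot_norm :: "real \<Rightarrow> laurent \<Rightarrow> real" where
  "rot_norm \<theta> f = (SUP N\<in>{N. cstar_seminorm \<theta> N}. N f)"

text \<open>
  Invertibility in the universal C*-algebra, that is, in the completion for this norm: the inverse
  is represented by a Cauchy sequence.
\<close>

definition rot_invertible :: "real \<Rightarrow> laurent \<Rightarrow> bool" where
  "rot_invertible \<theta> a \<longleftrightarrow> (\<exists>g :: nat \<Rightarrow> laurent.
     (\<forall>n. g n \<in> laurents) \<and>
     (\<forall>e>0. \<exists>K. \<forall>m\<ge>K. \<forall>n\<ge>K. rot_norm \<theta> (\<lambda>i. g m i - g n i) < e) \<and>
     (\<lambda>n. rot_norm \<theta> (\<lambda>i. rot_mult \<theta> a (g n) i - rot_one i)) \<longlonglongrightarrow> 0 \<and>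
     (\<lambda>n. rot_norm \<theta> (\<lambda>i. rot_mult \<theta> (g n) a i - rot_one i)) \<longlonglongrightarrow> 0)"

text \<open>Only real points are needed, because \<open>h\<close> is self-adjoint.\<close>

definition Spec :: "real \<Rightarrow> real set" where
  "Spec \<theta> = {x. \<not> rot_invertible \<theta> (\<lambda>i. of_real x * rot_one i - rot_h i)}"

definition rational_butterfly :: "(real \<times> rat) set" where
  "rational_butterfly = {(x, \<theta>). 0 \<le> \<theta> \<and> \<theta> \<le> 1 \<and> x \<in> Spec (of_rat \<theta>)}"


section \<open>Bands and polynomials\<close>

definition numer :: "rat \<Rightarrow> int" where
  "numer \<theta> = fst (quotient_of \<theta>)"

definition denom :: "rat \<Rightarrow> int" where
  "denom \<theta> = snd (quotient_of \<theta>)"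

definition is_band_numbering :: "rat \<Rightarrow> (int \<Rightarrow> real set) \<Rightarrow> bool" where
  "is_band_numbering \<theta> I \<longleftrightarrow>
     (\<forall>k\<in>{1..denom \<theta>}. \<exists>l r. l \<le> r \<and> I k = {l..r}) \<and>
     (\<forall>k. k \<notin> {1..denom \<theta>} \<longrightarrow> I k = {}) \<and>
     (\<Union>k\<in>{1..denom \<theta>}. I k) = Spec (of_rat \<theta>) \<and>
     (\<forall>j k. 1 \<le> j \<and> j < k \<and> k \<le> denom \<theta> \<longrightarrow>
        (\<forall>x\<in>I j. \<forall>y\<in>I k. x \<le> y) \<and>
        I j \<inter> I k = (if even (denom \<theta>) \<and> j = denom \<theta> div 2 \<and> k = denom \<theta> div 2 + 1
                      then {0} else {}))"

definition band :: "rat \<Rightarrow> int \<Rightarrow> real set" where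
  "band \<theta> = (THE I. is_band_numbering \<theta> I)"

definition shift_mat :: "nat \<Rightarrow> complex mat" where
  "shift_mat q = mat q q (\<lambda>(i, j). if i = (j + 1) mod q then 1 else 0)"

definition clock_mat :: "rat \<Rightarrow> complex mat" where
  "clock_mat \<theta> = mat (nat (denom \<theta>)) (nat (denom \<theta>))
     (\<lambda>(i, j). if i = j then cis (2 * pi * of_rat \<theta>) ^ i else 0)"

definition butterfly_poly :: "rat \<Rightarrow> real \<Rightarrow> complex" where
  "butterfly_poly \<theta> x =
     (let q = nat (denom \<theta>); U = shift_mat q; V = clock_mat \<theta> in
        det (of_real x \<cdot>\<^sub>m 1\<^sub>m q - (U + mat_adjoint U + V + mat_adjoint V)) + 4)"


section \<open>Gaps and their labels\<close>

text \<open>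
  A gap is recorded with its level and its number, because the open interval alone does not
  determine them when it is empty.
\<close>

type_synonym gap = "rat \<times> int \<times> real set"

definition gap :: "rat \<Rightarrow> int \<Rightarrow> gap" where
  "gap \<theta> k = (\<theta>, k, {x. (\<forall>y\<in>band \<theta> k. y < x) \<and> (\<forall>y\<in>band \<theta> (k + 1). x < y)})"

definition gap_label :: "int \<Rightarrow> int \<Rightarrow> bool" where
  "gap_label s t \<longleftrightarrow> (0 < t \<and> 0 \<le> s \<and> s \<le> t - 1) \<or> (t < 0 \<and> t \<le> s \<and> s \<le> - 1)"

definition is_gap_labeled :: "rat \<Rightarrow> int \<Rightarrow> int \<Rightarrow> gap \<Rightarrow> bool" where
  "is_gap_labeled \<theta> s t G \<longleftrightarrow> gap_label s t \<and>
     (\<exists>k. k = t * numer \<theta> - s * denom \<theta> \<and> 1 \<le> k \<and> k \<le> denom \<theta> - 1 \<and> G = gap \<theta> k)"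


section \<open>Similarity maps\<close>

datatype sign = Plus | Minus

definition moebius :: "int \<Rightarrow> int \<Rightarrow> int \<Rightarrow> int \<Rightarrow> 'a::field_char_0 \<Rightarrow> 'a" where
  "moebius a b c d \<theta> = (of_int a * \<theta> + of_int b) / (of_int c * \<theta> + of_int d)"

text \<open>
  The number \<open>k' - k\<close> by which indices are raised, as a function of the target level \<open>p'/q'\<close>. For
  \<open>Plus\<close> it is \<open>r p' - 0 q'\<close> and for \<open>Minus\<close> it is \<open>(- r) p' - (- r) q'\<close>; in terms of labels, the vectors
  \<open>(0, r)\<close> and \<open>- (r, r)\<close> are added. Adding \<open>+ (r, r)\<close> for \<open>Minus\<close> would lower indices instead: for
  \<open>\<theta>' = 1/(\<theta> + 1)\<close> and \<open>r = 1\<close> the gap labeled \<open>(1, 4)\<close> at level \<open>2/5\<close> is the third one and goes to the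
  fifth one at level \<open>5/7\<close>, which is labeled \<open>(- 5, - 6)\<close>, whereas \<open>(- 3, - 4)\<close> labels the first one.
\<close>

definition index_shift :: "int \<Rightarrow> sign \<Rightarrow> rat \<Rightarrow> int" where
  "index_shift r sg \<theta>' = (case sg of Plus \<Rightarrow> r * numer \<theta>' | Minus \<Rightarrow> r * (denom \<theta>' - numer \<theta>'))"

definition similarity_params :: "int \<Rightarrow> int \<Rightarrow> int \<Rightarrow> int \<Rightarrow> int \<Rightarrow> sign \<Rightarrow> bool" where
  "similarity_params a b c d r sg \<longleftrightarrow>
     \<bar>a * d - b * c\<bar> = 1 \<and>
     (\<forall>x::real. 0 \<le> x \<and> x \<le> 1 \<longrightarrow> 0 < of_int c * x + of_int d) \<and>
     (\<forall>x::real. 0 \<le> x \<and> x \<le> 1 \<longrightarrow> 0 \<le> moebius a b c d x \<and> moebius a b c d x \<le> 1) \<and>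
     0 \<le> r \<and>
     (\<forall>\<theta>::rat. 0 \<le> \<theta> \<and> \<theta> \<le> 1 \<longrightarrow>
        index_shift r sg (moebius a b c d \<theta>) + denom \<theta> \<le> denom (moebius a b c d \<theta>))"

text \<open>
  A similarity map consists of its action on points, which is a relation since it is two-valued at
  the common point of the two middle bands, and of its action on gaps.
\<close>

record butterfly_map =
  on_points :: "((real \<times> rat) \<times> (real \<times> rat)) set"
  on_gaps :: "gap \<Rightarrow> gap"

definition similarity_map :: "int \<Rightarrow> int \<Rightarrow> int \<Rightarrow> int \<Rightarrow> int \<Rightarrow> sign \<Rightarrow> butterfly_map" where
  "similarity_map a b c d r sg = \<lparr>
     on_points = {((x, \<theta>), (x', \<theta>')). (x, \<theta>) \<in> rational_butterfly \<and> \<theta>' = moebius a b c d \<theta> \<and>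
       (\<exists>k\<in>{1..denom \<theta>}. \<exists>k'. k' = index_shift r sg \<theta>' + k \<and>
          x \<in> band \<theta> k \<and> x' \<in> band \<theta>' k' \<and>
          (- 1) powi (denom \<theta> + k) * butterfly_poly \<theta> x =
          (- 1) powi (denom \<theta>' + k') * butterfly_poly \<theta>' x')},
     on_gaps = (\<lambda>(\<theta>, k, _). let \<theta>' = moebius a b c d \<theta> in gap \<theta>' (index_shift r sg \<theta>' + k))\<rparr>"

end

theory Submission
  imports Defs
begin

text \<open>
  For \<open>\<theta> = p/q\<close> the image level is \<open>(a p + b q)/(c p + d q)\<close>, still in lowest terms because the
  determinant is \<open>\<plusminus>1\<close>. Hence \<open>t p - s q\<close> is a determinant which the matrix multiplies by
  \<open>a d - b c\<close>, and this proves the formula for the gap number. To see that the new pair is again an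
  admissible label, regard \<open>s/t\<close> itself as a rational level: with \<open>N/Q\<close> its image, the parameter
  condition on \<open>r\<close> at \<open>s/t\<close> and monotonicity of the Moebius map (in the form of the sign of
  \<open>Q p' - N q'\<close>) bound the coordinates \<open>\<plusminus>N\<close> and \<open>\<plusminus>Q\<close> after translation by \<open>r\<close>.
\<close>

section \<open>Lowest terms and the action of the matrix on fractions\<close>

lemma denom_pos: "0 < denom \<theta>"
  by (simp add: denom_def quotient_of_denom_pos')

lemma coprime_numer_denom: "coprime (numer \<theta>) (denom \<theta>)"
  by (simp add: denom_def numer_def quotient_of_coprime)

lemma rat_eq_numer_div_denom: "\<theta> = of_int (numer \<theta>) / of_int (denom \<theta>)"
  by (metis denom_def numer_def prod.collapse quotient_of_div)

lemma numer_denom_of_int_div: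
  assumes "0 < q" "coprime p q"
  shows "numer (of_int p / of_int q) = p" "denom (of_int p / of_int q) = q"
  using assms by (simp_all add: numer_def denom_def flip: Fract_of_int_quotient,
    simp_all add: quotient_of_Fract Rat.normalize_def coprime_iff_gcd_eq_1 Let_def)

lemma numer_nonneg: "0 \<le> \<theta> \<Longrightarrow> 0 \<le> numer \<theta>"
  using denom_pos[of \<theta>] rat_eq_numer_div_denom[of \<theta>]
  by (metis of_int_0_le_iff of_int_pos zero_le_divide_iff not_less)

lemma numer_le_denom: "\<theta> \<le> 1 \<Longrightarrow> numer \<theta> \<le> denom \<theta>"
  using denom_pos[of \<theta>] rat_eq_numer_div_denom[of \<theta>]
  by (metis divide_le_eq_1_pos of_int_le_iff of_int_0_less_iff)

text \<open>The adjugate matrix recovers \<open>p\<close> and \<open>q\<close>, up to the sign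
  \<open>a * d - b * c\<close>, from the two image entries, so a common divisor of these divides
  both.\<close>

lemma coprime_image_unimodular:
  fixes a b c d p q :: int
  assumes "\<bar>a * d - b * c\<bar> = 1" "coprime p q"
  shows "coprime (a * p + b * q) (c * p + d * q)"
proof (rule coprimeI)
  fix g assume "g dvd a * p + b * q" "g dvd c * p + d * q"
  then have "g dvd d * (a * p + b * q) - b * (c * p + d * q)"
    "g dvd a * (c * p + d * q) - c * (a * p + b * q)"
    by (auto intro: dvd_diff dvd_mult)
  then have "g dvd (a * d - b * c) * p" "g dvd (a * d - b * c) * q"
    by (simp_all add: algebra_simps)
  moreover have "a * d - b * c = 1 \<or> a * d - b * c = - 1"
    using assms(1) by linarith
  ultimately have "g dvd p" "g dvd q"
    by auto
  with assms(2) show "is_unit g"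
    by (rule coprime_common_divisor)
qed

lemma moebius_of_int_div:
  fixes q :: int
  assumes "0 < q"
  shows "(moebius a b c d (of_int p / of_int q) :: 'a::linordered_field) =
    of_int (a * p + b * q) / of_int (c * p + d * q)"
proof -
  have "of_int a * (of_int p / of_int q) + of_int b = (of_int (a * p + b * q) / of_int q :: 'a)"
    "of_int c * (of_int p / of_int q) + of_int d = (of_int (c * p + d * q) / of_int q :: 'a)"
    using assms by (simp_all add: field_simps)
  with assms show ?thesis
    by (simp add: moebius_def)
qed

text \<open>Coprimality is not assumed, because this is applied to labels as well as to
  levels.\<close>

lemma similarity_params_fraction:
  assumes "similarity_params a b c d r sg" "0 \<le> p" "p \<le> q" "0 < q"
  shows "0 < c * p + d * q" "0 \<le> a * p + b * q" "a * p + b * q \<le> c * p + d * q"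
proof -
  define x :: real where "x = of_int p / of_int q"
  have x: "0 \<le> x" "x \<le> 1"
    using assms by (simp_all add: x_def)
  have "0 < of_int c * x + of_int d"
    using assms(1) x unfolding similarity_params_def by blast
  moreover have "of_int c * x + of_int d = of_int (c * p + d * q) / of_int q"
    using assms by (simp add: x_def field_simps)
  ultimately have "(0::real) < of_int (c * p + d * q)"
    using assms(4) by (simp add: zero_less_divide_iff)
  then show pos: "0 < c * p + d * q"
    by (simp only: of_int_0_less_iff)
  have m: "0 \<le> moebius a b c d x" "moebius a b c d x \<le> 1"
    using assms(1) x unfolding similarity_params_def by blast+
  have e: "moebius a b c d x = of_int (a * p + b * q) / of_int (c * p + d * q)"
    unfolding x_def using assms(4) by (rule moebius_of_int_div)
  have pos': "(0::real) < of_int (c * p + d * q)"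
    using pos by (simp only: of_int_0_less_iff)
  have "(0::real) \<le> of_int (a * p + b * q)"
    using m(1) pos' unfolding e zero_le_divide_iff by linarith
  then show "0 \<le> a * p + b * q"
    by (simp only: of_int_0_le_iff)
  have "(of_int (a * p + b * q) :: real) \<le> of_int (c * p + d * q)"
    using m(2) pos' unfolding e by (simp only: divide_le_eq_1_pos)
  then show "a * p + b * q \<le> c * p + d * q"
    by (simp only: of_int_le_iff)
qed

lemma numer_denom_moebius:
  assumes "similarity_params a b c d r sg" "0 \<le> \<theta>" "\<theta> \<le> 1"
  shows "numer (moebius a b c d \<theta>) = a * numer \<theta> + b * denom \<theta>"
    "denom (moebius a b c d \<theta>) = c * numer \<theta> + d * denom \<theta>"
proof -
  let ?p = "numer \<theta>" and ?q = "denom \<theta>"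
  have "moebius a b c d \<theta> = of_int (a * ?p + b * ?q) / of_int (c * ?p + d * ?q)"
    using moebius_of_int_div[OF denom_pos, of a b c d ?p \<theta>] rat_eq_numer_div_denom[of \<theta>] by metis
  moreover have "0 < c * ?p + d * ?q"
    using assms by (intro similarity_params_fraction[OF assms(1)] numer_nonneg numer_le_denom denom_pos)
  moreover have "coprime (a * ?p + b * ?q) (c * ?p + d * ?q)"
    using assms(1) coprime_numer_denom
    by (intro coprime_image_unimodular) (simp_all add: similarity_params_def)
  ultimately show "numer (moebius a b c d \<theta>) = a * ?p + b * ?q"
    "denom (moebius a b c d \<theta>) = c * ?p + d * ?q"
    using numer_denom_of_int_div by metis+
qed

text \<open>The condition on \<open>r\<close>, which is imposed in lowest terms, is homogeneous in \<open>(p, q)\<close>.\<close>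

lemma similarity_params_shift_fraction:
  assumes "similarity_params a b c d r sg" "0 \<le> p" "p \<le> q" "0 < q"
  shows "(case sg of Plus \<Rightarrow> r * (a * p + b * q)
      | Minus \<Rightarrow> r * ((c * p + d * q) - (a * p + b * q))) + q \<le> c * p + d * q"
proof -
  define g where "g = gcd p q"
  define p0 where "p0 = p div g"
  define q0 where "q0 = q div g"
  have g: "0 < g" "p = g * p0" "q = g * q0"
    using assms(4) by (simp_all add: g_def p0_def q0_def)
  have "coprime p0 q0"
    unfolding p0_def q0_def g_def using assms(4) by (intro div_gcd_coprime) simp
  moreover have q0: "0 < q0"
    using g assms(4) by (simp add: zero_less_mult_iff)
  moreover define \<theta> :: rat where "\<theta> = of_int p0 / of_int q0"
  ultimately have nd: "numer \<theta> = p0" "denom \<theta> = q0"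
    by (simp_all add: numer_denom_of_int_div)
  have "0 \<le> p0" "p0 \<le> q0"
    using g assms(2,3) by (simp_all add: zero_le_mult_iff)
  then have \<theta>: "0 \<le> \<theta>" "\<theta> \<le> 1"
    using q0 by (simp_all add: \<theta>_def)
  have "index_shift r sg (moebius a b c d \<theta>) + denom \<theta> \<le> denom (moebius a b c d \<theta>)"
    using assms(1) \<theta> unfolding similarity_params_def by blast
  then have "(case sg of Plus \<Rightarrow> r * (a * p0 + b * q0)
      | Minus \<Rightarrow> r * ((c * p0 + d * q0) - (a * p0 + b * q0))) + q0 \<le> c * p0 + d * q0"
    unfolding index_shift_def numer_denom_moebius[OF assms(1) \<theta>] nd .
  then have "g * ((case sg of Plus \<Rightarrow> r * (a * p0 + b * q0)
      | Minus \<Rightarrow> r * ((c * p0 + d * q0) - (a * p0 + b * q0))) + q0) \<le> g * (c * p0 + d * q0)"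
    using g(1) by simp
  then show ?thesis
    unfolding g(2,3) by (cases sg) (simp_all add: algebra_simps)
qed

section \<open>Admissibility of the image label\<close>

lemma add_le_of_mult_add_le:
  fixes r n q t :: int
  assumes "0 \<le> r" "1 \<le> n" "n \<le> q" "1 \<le> t" "r * n + t \<le> q"
  shows "r + n \<le> q"
proof (cases "r = 0")
  case False
  \<comment> \<open>This product bound says \<open>r + n \<le> r * n + 1\<close>, and
    \<open>1 \<le> t\<close>.\<close>
  then have "0 \<le> (r - 1) * (n - 1)"
    using assms by simp
  with assms show ?thesis
    by (simp add: algebra_simps)
qed (use assms in simp)

text \<open>The vector \<open>(s, t)\<close> for which \<open>t * p' - s * q'\<close> is the index
  shift at level \<open>p'/q'\<close>.\<close>

definition label_shift :: "int \<Rightarrow> sign \<Rightarrow> int \<times> int" where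
  "label_shift r sg = (case sg of Plus \<Rightarrow> (0, r) | Minus \<Rightarrow> (- r, - r))"

lemma gap_label_image:
  assumes params: "similarity_params a b c d r sg"
    and \<theta>: "0 \<le> p" "p \<le> q" "0 < q"
    and label: "gap_label s t" and k: "0 < t * p - s * q"
  shows "gap_label ((a * d - b * c) * (a * s + b * t) + fst (label_shift r sg))
    ((a * d - b * c) * (c * s + d * t) + snd (label_shift r sg))"
proof -
  \<comment> \<open>Both kinds of label are \<open>e\<close> times a pair with
    \<open>0 \<le> S \<le> T\<close> and \<open>0 < T\<close>, so that \<open>S/T\<close> is a level
    in [0,1].\<close>
  define e where "e = sgn t"
  define S where "S = e * s"
  define T where "T = e * t"
  define D where "D = a * d - b * c"
  define N where "N = a * S + b * T"
  define Q where "Q = c * S + d * T"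
  have e: "e = 1 \<or> e = - 1"
    using label by (auto simp: e_def gap_label_def)
  have S: "0 \<le> S" "S \<le> T" "0 < T"
    using label by (auto simp: e_def S_def T_def gap_label_def)
  have st: "s = e * S" "t = e * T"
    using e by (auto simp: S_def T_def)
  have D: "D = 1 \<or> D = - 1" and r: "0 \<le> r"
    using params by (auto simp: similarity_params_def D_def)
  have N: "0 < Q" "0 \<le> N" "N \<le> Q"
    unfolding N_def Q_def by (fact similarity_params_fraction[OF params S])+
  have shift: "(case sg of Plus \<Rightarrow> r * N | Minus \<Rightarrow> r * (Q - N)) + T \<le> Q"
    unfolding N_def Q_def by (rule similarity_params_shift_fraction[OF params S])
  define p' where "p' = a * p + b * q"
  define q' where "q' = c * p + d * q"
  have p': "0 < q'" "0 \<le> p'" "p' \<le> q'"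
    unfolding p'_def q'_def by (fact similarity_params_fraction[OF params \<theta>])+
  \<comment> \<open>The matrix multiplies determinants by \<open>D\<close>; the sign of this one
    compares \<open>N/Q\<close> with \<open>p'/q'\<close>.\<close>
  have "Q * p' - N * q' = D * (T * p - S * q)"
    by (simp add: N_def Q_def p'_def q'_def D_def algebra_simps)
  also have "\<dots> = D * e * (t * p - s * q)"
    by (simp add: S_def T_def algebra_simps)
  finally have det: "Q * p' - N * q' = D * e * (t * p - s * q)" .
  have image: "(a * d - b * c) * (a * s + b * t) = D * e * N"
    "(a * d - b * c) * (c * s + d * t) = D * e * Q"
    by (simp_all add: st D_def N_def Q_def algebra_simps)
  \<comment> \<open>Before translation the image label is \<open>(N, Q)\<close> or
    \<open>(- N, - Q)\<close>. Positivity of the gap number gives \<open>N/Q < p'/q' \<le> 1\<close>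
    in the first case and \<open>N/Q > p'/q' \<ge> 0\<close> in the second.\<close>
  consider "D * e = 1" | "D * e = - 1"
    using D e by fastforce
  then show ?thesis
  proof cases
    case 1
    have "N * q' < Q * p'"
      using det k unfolding 1 by simp
    also have "\<dots> \<le> Q * q'"
      using N p' by simp
    finally have "N < Q"
      using p' by simp
    show ?thesis
    proof (cases sg)
      case Plus
      with \<open>N < Q\<close> N r show ?thesis
        unfolding image 1 by (simp add: gap_label_def label_shift_def)
    next
      case Minus
      \<comment> \<open>Here the translation moves the label towards the origin. The bound amounts
        to \<open>r \<le> N\<close>, which keeps the first coordinate \<open>N - r\<close>
        nonnegative.\<close>
      have "r + (Q - N) \<le> Q"
        using shift Minus \<open>N < Q\<close> N r S
        by - (rule add_le_of_mult_add_le[where t = T], auto)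
      with Minus \<open>N < Q\<close> show ?thesis
        unfolding image 1 by (simp add: gap_label_def label_shift_def)
    qed
  next
    case 2
    have "0 \<le> Q * p'"
      using N p' by simp
    also have "\<dots> < N * q'"
      using det k unfolding 2 by simp
    finally have "0 < N"
      using p' by (simp add: zero_less_mult_iff)
    show ?thesis
    proof (cases sg)
      case Plus
      \<comment> \<open>The second coordinate becomes \<open>r - Q\<close>; this bound keeps it at
        most the first one, \<open>- N\<close>, and hence negative.\<close>
      have "r + N \<le> Q"
        using shift Plus \<open>0 < N\<close> N r S
        by - (rule add_le_of_mult_add_le[where t = T], auto)
      with Plus \<open>0 < N\<close> show ?thesis
        unfolding image 2 by (simp add: gap_label_def label_shift_def)
    next
      case Minus
      with \<open>0 < N\<close> N r show ?thesis
        unfolding image 2 by (simp add: gap_label_def label_shift_def)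
    qed
  qed
qed

section \<open>The action on labeled gaps\<close>

lemma on_gaps_similarity_map:
  "on_gaps (similarity_map a b c d r sg) (gap \<theta> k) =
    gap (moebius a b c d \<theta>) (index_shift r sg (moebius a b c d \<theta>) + k)"
  by (simp add: similarity_map_def gap_def Let_def)

lemma is_gap_labeled_image:
  assumes params: "similarity_params a b c d r sg"
    and \<theta>: "0 \<le> \<theta>" "\<theta> \<le> 1"
    and G: "is_gap_labeled \<theta> s t G"
  shows "is_gap_labeled (moebius a b c d \<theta>)
    ((a * d - b * c) * (a * s + b * t) + fst (label_shift r sg))
    ((a * d - b * c) * (c * s + d * t) + snd (label_shift r sg))
    (on_gaps (similarity_map a b c d r sg) G)"
proof -
  define p where "p = numer \<theta>"
  define q where "q = denom \<theta>"
  define D where "D = a * d - b * c"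
  define k where "k = t * p - s * q"
  define j where "j = index_shift r sg (moebius a b c d \<theta>)"
  have pq: "0 \<le> p" "p \<le> q" "0 < q"
    using \<theta> by (simp_all add: p_def q_def numer_nonneg numer_le_denom denom_pos)
  have label: "gap_label s t" and k: "1 \<le> k" "k \<le> q - 1" and Gk: "G = gap \<theta> k"
    using G by (auto simp: is_gap_labeled_def k_def p_def q_def)
  note nd = numer_denom_moebius[OF params \<theta>, folded p_def q_def]
  have "D * D = 1" "0 \<le> r"
    using params by (auto simp: similarity_params_def D_def abs_eq_iff')
  \<comment> \<open>The factor \<open>D\<close> in the label formula cancels the determinant
    contributed by the matrix, so only the index shift is added to \<open>k\<close>.\<close>
  have "D * (c * s + d * t) * (a * p + b * q) - D * (a * s + b * t) * (c * p + d * q) = D * D * k"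
    by (simp add: D_def k_def algebra_simps)
  then have index: "j + k = (D * (c * s + d * t) + snd (label_shift r sg)) * (a * p + b * q)
      - (D * (a * s + b * t) + fst (label_shift r sg)) * (c * p + d * q)"
    unfolding \<open>D * D = 1\<close> j_def index_shift_def label_shift_def nd
    by (cases sg) (simp_all add: algebra_simps)
  have "0 \<le> j"
    using \<open>0 \<le> r\<close> similarity_params_fraction[OF params pq]
    by (cases sg) (simp_all add: j_def index_shift_def nd)
  moreover have "j + q \<le> denom (moebius a b c d \<theta>)"
    using params \<theta> unfolding similarity_params_def j_def q_def by blast
  \<comment> \<open>The condition on \<open>r\<close> leaves room for all \<open>q\<close> shifted
    bands, hence for the gaps between them.\<close>
  ultimately have "1 \<le> j + k" "j + k \<le> denom (moebius a b c d \<theta>) - 1"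
    using k by simp_all
  moreover have "gap_label (D * (a * s + b * t) + fst (label_shift r sg))
      (D * (c * s + d * t) + snd (label_shift r sg))"
    unfolding D_def using k(1) by (intro gap_label_image[OF params pq label]) (simp add: k_def)
  moreover have "on_gaps (similarity_map a b c d r sg) G = gap (moebius a b c d \<theta>) (j + k)"
    by (simp add: Gk on_gaps_similarity_map j_def)
  ultimately show ?thesis
    unfolding is_gap_labeled_def nd index D_def by blast
qed

text \<open>For \<open>Minus\<close> the vector \<open>(r, r)\<close> is subtracted: adding it would
  change the index by \<open>r * (p' - q')\<close> instead of \<open>r * (q' - p')\<close>.\<close>

theorem theorem2:
  fixes a b c d r :: int
  shows
    "(similarity_params a b c d r Plus \<longrightarrow>
       (\<forall>s t s' t'. \<forall>\<theta>::rat. \<forall>G.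
          s' = (a * d - b * c) * (a * s + b * t) \<and>
          t' = (a * d - b * c) * (c * s + d * t) + r \<and>
          0 \<le> \<theta> \<and> \<theta> \<le> 1 \<and> is_gap_labeled \<theta> s t G \<longrightarrow>
          is_gap_labeled (moebius a b c d \<theta>) s' t'
            (on_gaps (similarity_map a b c d r Plus) G))) \<and>
     (similarity_params a b c d r Minus \<longrightarrow>
       (\<forall>s t s' t'. \<forall>\<theta>::rat. \<forall>G.
          s' = (a * d - b * c) * (a * s + b * t) - r \<and>
          t' = (a * d - b * c) * (c * s + d * t) - r \<and>
          0 \<le> \<theta> \<and> \<theta> \<le> 1 \<and> is_gap_labeled \<theta> s t G \<longrightarrow>
          is_gap_labeled (moebius a b c d \<theta>) s' t'
            (on_gaps (similarity_map a b c d r Minus) G)))"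
  using is_gap_labeled_image[of a b c d r Plus] is_gap_labeled_image[of a b c d r Minus]
  by (simp add: label_shift_def)

end
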